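(* Let $D\ge 1$ be an integer, let $\mu>0$, and let $\vec L_t$ ($t>0$) be $\mathbb{R}^D$-valued strictly operator stable random vectors with scaling index matrix $E=(D\mu)^{-1}I$ and with even negative logarithmic characteristic function $\phi$; that is, $$\mathbb{E}\left[e^{\imath\,\vec k\cdot\vec L_t}\right]=\exp\left(-t\,\phi(\vec k)\right)\quad\text{for all }\vec k\in\mathbb{R}^D,\ t>0,$$ where $\phi(-\vec k)=\phi(\vec k)$ for all $\vec k$ and $\phi(\vec k)=|\vec k|^{D\mu}\,\phi\left(\vec k/|\vec k|\right)$ for all $\vec k\neq 0$. Let $\vec\sigma\in\mathbb{R}^D\setminus\{0\}$ be a non-random vector, put $\sigma:=|\vec\sigma|$, and put $\phi_\pm:=\phi(\pm\vec\sigma/|\vec\sigma|)$ (the two signs give the same value because $\phi$ is even). Then for every real $\beta$ with $0<\beta<D\mu$ and every $t>0$ the moment $\mathbb{E}\left[(\vec\sigma\cdot\vec L_t)^\beta\right]$ exists and $$\mathbb{E}\left[(\vec\sigma\cdot\vec L_t)^\beta\right]=\mathfrak{C}(\beta,D\mu)\cdot\left(\sigma\,t^{1/(D\mu)}\right)^\beta\cdot\cos\left(\frac{\pi\beta}{2}\right)e^{\imath\beta\pi/2}\cdot\phi_\pm^{\beta/(D\mu)},$$ where $$\mathfrak{C}(\beta,D\mu):=\frac{2^{\beta+1}}{D\mu\sqrt{\pi}}\,\Gamma\left(\frac{\beta+1}{2}\right)\frac{\Gamma\left(-\frac{\beta}{D\mu}\right)}{\Gamma\left(-\frac{\beta}{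2}\right)}.$$
   Context: $I$ is the $D\times D$ identity matrix, $|\cdot|$ is the Euclidean norm and $\Gamma$ is the Gamma function. For a negative real number $x$ the real power is the complex number $x^\beta:=|x|^\beta e^{\imath\pi\beta}$ (that is, $(-1)^\beta=e^{\imath\pi\beta}$); for $x>0$ it is the usual positive power, and $0^\beta=0$ for $\beta>0$. "The moment exists" means that $\mathbb{E}\left[|\vec\sigma\cdot\vec L_t|^\beta\right]<\infty$. At a pole of $\Gamma(-\beta/2)$ the factor $1/\Gamma(-\beta/2)$ is read as $0$. *)

theory Defs
  imports "HOL-Probability.Probability"
begin

text \<open>
  Real power of a possibly negative real, with the branch \<open>(-1)\<^sup>\<beta> = exp (\<i> \<pi> \<beta>)\<close>.
  For \<open>x = 0\<close> the real \<open>powr\<close> gives \<open>0\<close>.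
\<close>

definition branch_power :: "real \<Rightarrow> real \<Rightarrow> complex" where
  "branch_power x \<beta> =
     (if x < 0 then complex_of_real (\<bar>x\<bar> powr \<beta>) * exp (\<i> * complex_of_real (pi * \<beta>))
      else complex_of_real (x powr \<beta>))"

lemma branch_power_eq_powr:
  "branch_power x \<beta> = complex_of_real x powr complex_of_real \<beta>"
proof (cases "x < 0")
  case True
  then have "Ln (complex_of_real x) = Ln (complex_of_real (- x)) + \<i> * complex_of_real pi"
    using Ln_minus[of "complex_of_real (- x)"] by simp
  also have "Ln (complex_of_real (- x)) = complex_of_real (ln \<bar>x\<bar>)"
    using True Ln_of_real[of "- x"] by (simp del: of_real_minus)
  finally have "Ln (complex_of_real x) = complex_of_real (ln \<bar>x\<bar>) + \<i> * complex_of_real pi" .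
  with True show ?thesis
    by (simp add: branch_power_def powr_def ring_distribs exp_add exp_of_real [symmetric] mult_ac)
next
  case False
  then show ?thesis
    by (simp add: branch_power_def powr_of_real)
qed

text \<open>
  In the library \<open>Gamma\<close> is \<open>0\<close> at its poles and \<open>x / 0 = 0\<close>, so \<open>1 / Gamma (- \<beta> / 2)\<close>
  is \<open>0\<close> whenever \<open>- \<beta> / 2\<close> is a pole (it equals \<open>rGamma (- \<beta> / 2)\<close>).
\<close>

definition moment_const :: "real \<Rightarrow> real \<Rightarrow> real" where
  "moment_const \<beta> \<alpha> =
     2 powr (\<beta> + 1) / (\<alpha> * sqrt pi) * Gamma ((\<beta> + 1) / 2)
       * (Gamma (- \<beta> / \<alpha>) / Gamma (- \<beta> / 2))"

end

theory Submission imports Defs begin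

text \<open>
  Evenness forces \<open>\<phi>\<close> to be real and nonnegative, so \<open>\<sigma> \<bullet> L t\<close> has the characteristic
  function \<open>exp (- c \<bar>u\<bar>\<^sup>\<alpha>)\<close> of a symmetric stable law, with \<open>\<alpha> = D \<mu>\<close>. Integrating the identity
  \<open>\<integral>\<^sub>0\<^sup>\<infinity> (1 - cos (u x)) u\<^sup>-\<^sup>1\<^sup>-\<^sup>\<beta> du = C \<bar>x\<bar>\<^sup>\<beta>\<close> against the law turns the absolute moment into the integral of
  \<open>(1 - exp (- c u\<^sup>\<alpha>)) u\<^sup>-\<^sup>1\<^sup>-\<^sup>\<beta>\<close>, a Gamma value; the constant \<open>C\<close> is found by applying this to the standard
  normal law. If \<open>\<alpha> > 2\<close>, the bound \<open>1 - cos (2 x) \<le> 4 (1 - cos x)\<close> forces \<open>c = 0\<close> and the law degenerates.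
\<close>

section \<open>Gamma integrals of stretched exponentials\<close>

text \<open>Substitute \<open>v = c * s powr \<alpha>\<close> in Euler's integral for
  \<open>Gamma (a / \<alpha>)\<close>. It serves the stable law and, with \<alpha> = 2 and c = 1/2,
  the Gaussian moments.\<close>

lemma nn_integral_powr_exp_powr:
  fixes a c \<alpha> :: real
  assumes "a > 0" "c > 0" "\<alpha> > 0"
  shows "(\<integral>\<^sup>+s\<in>{0<..}. ennreal (s powr (a - 1) * exp (- (c * s powr \<alpha>))) \<partial>lborel)
         = ennreal (c powr (- a / \<alpha>) * Gamma (a / \<alpha>) / \<alpha>)"
proof -
  define f where "f = (\<lambda>v::real. v powr (a / \<alpha> - 1) / exp v)"
  define g where "g = (\<lambda>s::real. c * s powr \<alpha>)"
  define g' where "g' = (\<lambda>s::real. c * (\<alpha> * s powr (\<alpha> - 1)))"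
  have "(f has_integral Gamma (a / \<alpha>)) {0..}"
    unfolding f_def using assms by (intro Gamma_integral_real) simp
  \<comment> \<open>The null point 0 is dropped because \<open>g\<close> need not be differentiable
    there when \<alpha> < 1.\<close>
  also have "?this \<longleftrightarrow> (f has_integral Gamma (a / \<alpha>)) {0<..}"
    by (rule has_integral_spike_set_eq; rule negligible_subset[of "{0}"]; auto)
  finally have f: "(f has_integral Gamma (a / \<alpha>)) {0<..}" .
  have "g ` {0<..} = {0<..}"
  proof (intro equalityI subsetI)
    fix v :: real assume v: "v \<in> {0<..}"
    have "v = g ((v / c) powr (1 / \<alpha>))" "(v / c) powr (1 / \<alpha>) \<in> {0<..}"
      using assms v by (simp_all add: g_def powr_powr)
    then show "v \<in> g ` {0<..}" by blast
  qed (use assms in \<open>auto simp: g_def\<close>)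
  moreover have "inj_on g {0<..}"
    using assms
    by (intro inj_on_inverseI[where g = "\<lambda>v. (v / c) powr (1 / \<alpha>)"]) (simp add: g_def powr_powr)
  moreover have "(g has_field_derivative g' s) (at s within {0<..})" if "s \<in> {0<..}" for s
    using that unfolding g_def g'_def by (auto intro!: derivative_eq_intros)
  moreover have "f absolutely_integrable_on {0<..} \<and> integral {0<..} f = Gamma (a / \<alpha>)"
    using f by (auto intro!: nonnegative_absolutely_integrable_1 integral_unique
        simp: f_def has_integral_integrable)
  ultimately have "(\<lambda>s. \<bar>g' s\<bar> * f (g s)) absolutely_integrable_on {0<..} \<and>
      integral {0<..} (\<lambda>s. \<bar>g' s\<bar> * f (g s)) = Gamma (a / \<alpha>)"
    by (subst has_absolute_integral_change_of_variables_1') auto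
  then have "((\<lambda>s. \<bar>g' s\<bar> * f (g s)) has_integral Gamma (a / \<alpha>)) {0<..}"
    by (simp add: has_integral_iff set_lebesgue_integral_eq_integral(1))
  \<comment> \<open>The factor is the reciprocal of \<open>\<alpha> * c powr (a / \<alpha>)\<close>,
    the constant that the Jacobian and \<open>f (g s)\<close> produce together.\<close>
  then have "((\<lambda>s. (c powr (- a / \<alpha>) / \<alpha>) * (\<bar>g' s\<bar> * f (g s)))
      has_integral (c powr (- a / \<alpha>) / \<alpha>) * Gamma (a / \<alpha>)) {0<..}"
    by (rule has_integral_mult_right)
  also have "?this \<longleftrightarrow> ((\<lambda>s. s powr (a - 1) * exp (- (c * s powr \<alpha>)))
      has_integral (c powr (- a / \<alpha>) / \<alpha>) * Gamma (a / \<alpha>)) {0<..}"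
  proof (intro has_integral_cong)
    fix s :: real assume "s \<in> {0<..}"
    then have s: "s > 0" by simp
    have "\<alpha> * (a / \<alpha> - 1) = a - \<alpha>"
      using assms by (simp add: field_simps)
    then have "f (g s) = c powr (a / \<alpha> - 1) * s powr (a - \<alpha>) * exp (- (c * s powr \<alpha>))"
      using assms s
      by (simp add: f_def g_def powr_mult powr_powr exp_minus divide_inverse)
    moreover have "\<bar>g' s\<bar> = c * \<alpha> * s powr (\<alpha> - 1)"
      using assms s by (simp add: g'_def abs_mult)
    ultimately have "(c powr (- a / \<alpha>) / \<alpha>) * (\<bar>g' s\<bar> * f (g s))
       = (c powr (- a / \<alpha>) * c powr 1 * c powr (a / \<alpha> - 1))
         * (s powr (\<alpha> - 1) * s powr (a - \<alpha>)) * exp (- (c * s powr \<alpha>))"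
      using assms by simp
    also have "\<dots> = s powr (a - 1) * exp (- (c * s powr \<alpha>))"
      unfolding powr_add[symmetric] using assms by simp
    finally show "(c powr (- a / \<alpha>) / \<alpha>) * (\<bar>g' s\<bar> * f (g s)) = s powr (a - 1) * exp (- (c * s powr \<alpha>))" .
  qed
  finally show ?thesis
    by (subst nn_integral_has_integral_lebesgue') (auto simp: mult_ac)
qed

lemma nn_integral_powr_tail:
  fixes \<beta> s :: real
  assumes "\<beta> > 0" "s > 0"
  shows "(\<integral>\<^sup>+u\<in>{s..}. ennreal (u powr (- 1 - \<beta>)) \<partial>lborel) = ennreal (s powr - \<beta> / \<beta>)"
proof -
  have "(\<integral>\<^sup>+u\<in>{s..}. ennreal (u powr (- 1 - \<beta>)) \<partial>lborel)
      = ennreal (0 - (- (s powr - \<beta> / \<beta>)))"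
  proof (rule nn_integral_FTC_atLeast[where F = "\<lambda>u. - (u powr - \<beta> / \<beta>)"])
    show "((\<lambda>u. - (u powr - \<beta> / \<beta>)) has_real_derivative u powr (- 1 - \<beta>)) (at u)"
      if "s \<le> u" for u
      using that assms by (auto intro!: derivative_eq_intros simp: minus_diff_commute)
    have "((\<lambda>u::real. u powr - \<beta>) \<longlongrightarrow> 0) at_top"
      using assms by (intro tendsto_neg_powr filterlim_ident) auto
    then show "((\<lambda>u. - (u powr - \<beta> / \<beta>)) \<longlongrightarrow> 0) at_top"
      by (auto intro!: tendsto_minus_cancel_left[THEN iffD1] tendsto_divide_zero)
  qed auto
  then show ?thesis by simp
qed

lemma nn_integral_deriv_exp_powr:
  fixes c \<alpha> u :: real
  assumes "c > 0" "\<alpha> > 0" "u > 0"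
  shows "(\<integral>\<^sup>+s\<in>{0<..u}. ennreal (c * \<alpha> * s powr (\<alpha> - 1) * exp (- (c * s powr \<alpha>))) \<partial>lborel)
         = ennreal (1 - exp (- (c * u powr \<alpha>)))"
proof -
  let ?F = "\<lambda>s. - exp (- (c * s powr \<alpha>))"
  let ?f = "\<lambda>s. c * \<alpha> * s powr (\<alpha> - 1) * exp (- (c * s powr \<alpha>))"
  have "(?f has_integral ?F u - ?F 0) {0..u}"
  \<comment> \<open>The interior version asks only for continuity at the endpoints; for \<alpha> < 1
    the derivative blows up at 0.\<close>
  proof (rule fundamental_theorem_of_calculus_interior)
    show "continuous_on {0..u} ?F"
      using assms by (intro continuous_intros continuous_on_powr') auto
    show "(?F has_vector_derivative ?f s) (at s)" if "s \<in> {0<..<u}" for s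
      using that assms unfolding has_real_derivative_iff_has_vector_derivative[symmetric]
      by (auto intro!: derivative_eq_intros)
  qed (use assms in auto)
  also have "?this \<longleftrightarrow> (?f has_integral ?F u - ?F 0) {0<..u}"
    by (rule has_integral_spike_set_eq; rule negligible_subset[of "{0}"]; auto)
  finally show ?thesis
    using assms by (subst nn_integral_has_integral_lebesgue') auto
qed

text \<open>Integration by parts in the form of Tonelli's theorem: the first factor is the integral
  of its derivative over \<open>0 < s \<le> u\<close>, and swapping the order turns
  \<open>u powr (- 1 - \<beta>)\<close> into its tail \<open>s powr - \<beta> / \<beta>\<close>.
  What remains is a Gamma integral with exponent \<alpha> - \<beta>, positive by assumption.\<close>

lemma nn_integral_one_minus_exp_powr:
  fixes \<alpha> \<beta> c :: real
  assumes "0 < \<beta>" "\<beta> < \<alpha>" "c > 0"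
  shows "(\<integral>\<^sup>+u\<in>{0<..}. ennreal ((1 - exp (- (c * u powr \<alpha>))) * u powr (- 1 - \<beta>)) \<partial>lborel)
         = ennreal (c powr (\<beta> / \<alpha>) * Gamma (1 - \<beta> / \<alpha>) / \<beta>)"
proof -
  let ?h = "\<lambda>s. c * \<alpha> * s powr (\<alpha> - 1) * exp (- (c * s powr \<alpha>))"
  have \<alpha>: "\<alpha> > 0" using assms by simp
  have "(\<integral>\<^sup>+u\<in>{0<..}. ennreal ((1 - exp (- (c * u powr \<alpha>))) * u powr (- 1 - \<beta>)) \<partial>lborel)
      = (\<integral>\<^sup>+u. (\<integral>\<^sup>+s. ennreal (?h s) * ennreal (u powr (- 1 - \<beta>))
            * indicator {p. 0 < fst p \<and> fst p \<le> snd p} (s, u) \<partial>lborel) \<partial>lborel)"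
  proof (intro nn_integral_cong)
    fix u :: real
    show "ennreal ((1 - exp (- (c * u powr \<alpha>))) * u powr (- 1 - \<beta>)) * indicator {0<..} u
      = (\<integral>\<^sup>+s. ennreal (?h s) * ennreal (u powr (- 1 - \<beta>))
            * indicator {p. 0 < fst p \<and> fst p \<le> snd p} (s, u) \<partial>lborel)"
    proof (cases "u > 0")
      case True
      have "(\<integral>\<^sup>+s. ennreal (?h s) * ennreal (u powr (- 1 - \<beta>))
            * indicator {p. 0 < fst p \<and> fst p \<le> snd p} (s, u) \<partial>lborel)
          = (\<integral>\<^sup>+s. (ennreal (?h s) * indicator {0<..u} s) * ennreal (u powr (- 1 - \<beta>)) \<partial>lborel)"
        by (intro nn_integral_cong) (auto simp: indicator_def)
      also have "\<dots> = ennreal (1 - exp (- (c * u powr \<alpha>))) * ennreal (u powr (- 1 - \<beta>))"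
        using assms True by (simp add: nn_integral_multc nn_integral_deriv_exp_powr)
      finally show ?thesis
        using True assms by (simp add: ennreal_mult)
    next
      case False
      then have "indicator {p. 0 < fst p \<and> fst p \<le> snd p} (s, u) = (0::ennreal)" for s :: real
        by (auto simp: indicator_def)
      then show ?thesis using False by simp
    qed
  qed
  also have "\<dots> = (\<integral>\<^sup>+s. (\<integral>\<^sup>+u. ennreal (?h s) * ennreal (u powr (- 1 - \<beta>))
            * indicator {p. 0 < fst p \<and> fst p \<le> snd p} (s, u) \<partial>lborel) \<partial>lborel)"
    by (rule lborel_pair.Fubini') measurable
  also have "\<dots> = (\<integral>\<^sup>+s. ennreal (c * \<alpha> / \<beta>) *
      (ennreal (s powr ((\<alpha> - \<beta>) - 1) * exp (- (c * s powr \<alpha>))) * indicator {0<..} s) \<partial>lborel)"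
  proof (intro nn_integral_cong)
    fix s :: real
    show "(\<integral>\<^sup>+u. ennreal (?h s) * ennreal (u powr (- 1 - \<beta>))
            * indicator {p. 0 < fst p \<and> fst p \<le> snd p} (s, u) \<partial>lborel)
        = ennreal (c * \<alpha> / \<beta>) *
          (ennreal (s powr ((\<alpha> - \<beta>) - 1) * exp (- (c * s powr \<alpha>))) * indicator {0<..} s)"
    proof (cases "s > 0")
      case True
      have "(\<integral>\<^sup>+u. ennreal (?h s) * ennreal (u powr (- 1 - \<beta>))
            * indicator {p. 0 < fst p \<and> fst p \<le> snd p} (s, u) \<partial>lborel)
          = (\<integral>\<^sup>+u. ennreal (?h s) * (ennreal (u powr (- 1 - \<beta>)) * indicator {s..} u) \<partial>lborel)"
        using True by (intro nn_integral_cong) (auto simp: indicator_def)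
      also have "\<dots> = ennreal (?h s) * ennreal (s powr - \<beta> / \<beta>)"
        using assms True by (simp add: nn_integral_cmult nn_integral_powr_tail)
      also have "\<dots> = ennreal (?h s * (s powr - \<beta> / \<beta>))"
        using assms by (intro ennreal_mult[symmetric]) auto
      also have "?h s * (s powr - \<beta> / \<beta>)
          = c * \<alpha> / \<beta> * ((s powr (\<alpha> - 1) * s powr - \<beta>) * exp (- (c * s powr \<alpha>)))"
        by simp
      also have "s powr (\<alpha> - 1) * s powr - \<beta> = s powr ((\<alpha> - \<beta>) - 1)"
        by (simp flip: powr_add add: algebra_simps)
      finally show ?thesis
        using assms True by (simp flip: ennreal_mult)
    next
      case False
      then have "indicator {p. 0 < fst p \<and> fst p \<le> snd p} (s, u) = (0::ennreal)" for u :: real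
        by (auto simp: indicator_def)
      then show ?thesis using False by simp
    qed
  qed
  also have "\<dots> = ennreal (c * \<alpha> / \<beta>)
      * ennreal (c powr (- (\<alpha> - \<beta>) / \<alpha>) * Gamma ((\<alpha> - \<beta>) / \<alpha>) / \<alpha>)"
    using assms by (subst nn_integral_cmult) (simp_all add: nn_integral_powr_exp_powr)
  also have "\<dots> = ennreal (c * \<alpha> / \<beta> * (c powr (- (\<alpha> - \<beta>) / \<alpha>) * Gamma ((\<alpha> - \<beta>) / \<alpha>) / \<alpha>))"
    using assms by (simp flip: ennreal_mult)
  also have "(\<alpha> - \<beta>) / \<alpha> = 1 - \<beta> / \<alpha>"
    using assms by (simp add: field_simps)
  also have "- (\<alpha> - \<beta>) / \<alpha> = \<beta> / \<alpha> - 1"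
    using assms by (simp add: field_simps)
  also have "c * \<alpha> / \<beta> * (c powr (\<beta> / \<alpha> - 1) * Gamma (1 - \<beta> / \<alpha>) / \<alpha>)
      = c powr (\<beta> / \<alpha>) * Gamma (1 - \<beta> / \<alpha>) / \<beta>"
    using assms by (simp add: powr_diff)
  finally show ?thesis .
qed

section \<open>Absolute moments from characteristic functions\<close>

text \<open>Replace u by \<open>u / \<bar>x\<bar>\<close>; the power and the Jacobian together give
  \<open>\<bar>x\<bar> powr \<beta>\<close>. In \<open>ennreal\<close> the identity also covers
  \<beta> \<ge> 2, where the constant is infinite; at x = 0 both sides are then still 0.\<close>

lemma nn_integral_one_minus_cos_scale:
  fixes \<beta> x :: real
  assumes "\<beta> > 0"
  shows "(\<integral>\<^sup>+u\<in>{0<..}. ennreal ((1 - cos (u * x)) * u powr (- 1 - \<beta>)) \<partial>lborel)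
    = (\<integral>\<^sup>+u\<in>{0<..}. ennreal ((1 - cos u) * u powr (- 1 - \<beta>)) \<partial>lborel) * ennreal (\<bar>x\<bar> powr \<beta>)"
proof (cases "x = 0")
  case False
  have "(\<integral>\<^sup>+u\<in>{0<..}. ennreal ((1 - cos (u * x)) * u powr (- 1 - \<beta>)) \<partial>lborel)
      = (\<integral>\<^sup>+u\<in>{0<..}. ennreal ((1 - cos (u * \<bar>x\<bar>)) * u powr (- 1 - \<beta>)) \<partial>lborel)"
    by (intro nn_integral_cong) (auto simp: abs_if)
  also have "\<dots> = ennreal \<bar>1 / \<bar>x\<bar>\<bar> * (\<integral>\<^sup>+u. ennreal ((1 - cos ((0 + 1 / \<bar>x\<bar> * u) * \<bar>x\<bar>)) * (0 + 1 / \<bar>x\<bar> * u) powr (- 1 - \<beta>))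
       * indicator {0<..} (0 + 1 / \<bar>x\<bar> * u) \<partial>lborel)"
    using False by (subst nn_integral_real_affine[where c = "1 / \<bar>x\<bar>" and t = 0]) auto
  also have "\<dots> = (\<integral>\<^sup>+u. ennreal \<bar>1 / \<bar>x\<bar>\<bar> * (ennreal ((1 - cos ((0 + 1 / \<bar>x\<bar> * u) * \<bar>x\<bar>)) * (0 + 1 / \<bar>x\<bar> * u) powr (- 1 - \<beta>))
       * indicator {0<..} (0 + 1 / \<bar>x\<bar> * u)) \<partial>lborel)"
    by (rule nn_integral_cmult[symmetric]) measurable
  also have "\<dots> = (\<integral>\<^sup>+u. (ennreal ((1 - cos u) * u powr (- 1 - \<beta>)) * indicator {0<..} u) * ennreal (\<bar>x\<bar> powr \<beta>) \<partial>lborel)"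
  proof (intro nn_integral_cong)
    fix u :: real
    show "ennreal \<bar>1 / \<bar>x\<bar>\<bar> * (ennreal ((1 - cos ((0 + 1 / \<bar>x\<bar> * u) * \<bar>x\<bar>)) * (0 + 1 / \<bar>x\<bar> * u) powr (- 1 - \<beta>))
       * indicator {0<..} (0 + 1 / \<bar>x\<bar> * u))
      = (ennreal ((1 - cos u) * u powr (- 1 - \<beta>)) * indicator {0<..} u) * ennreal (\<bar>x\<bar> powr \<beta>)"
    proof (cases "u > 0")
      case True
      have "\<bar>1 / \<bar>x\<bar>\<bar> * (u / \<bar>x\<bar>) powr (- 1 - \<beta>) = u powr (- 1 - \<beta>) * \<bar>x\<bar> powr \<beta>"
        using True False by (simp add: powr_divide powr_diff powr_minus field_simps)
      then have "\<bar>1 / \<bar>x\<bar>\<bar> * ((1 - cos u) * (u / \<bar>x\<bar>) powr (- 1 - \<beta>))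
          = (1 - cos u) * u powr (- 1 - \<beta>) * \<bar>x\<bar> powr \<beta>"
        by (metis mult.assoc mult.left_commute)
      then show ?thesis
        using True False by (simp flip: ennreal_mult)
    next
      case u: False
      then have "\<not> 1 / \<bar>x\<bar> * u > 0" using False by (simp add: zero_less_divide_iff)
      then show ?thesis using u by (simp add: indicator_def)
    qed
  qed
  finally show ?thesis by (simp add: nn_integral_multc)
qed auto

text \<open>Here \<open>m\<close> is not known to be finite beforehand. Finiteness of the moments is
  obtained through this division.\<close>

lemma ennreal_eq_divideI:
  assumes "a > 0" "b \<ge> 0" "ennreal a * m = ennreal b"
  shows "m = ennreal (b / a)"
proof -
  have "m = ennreal (1 / a) * (ennreal a * m)"
    using assms(1) by (simp flip: mult.assoc ennreal_mult)
  also have "\<dots> = ennreal (b / a)"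
    using assms by (simp flip: ennreal_mult)
  finally show ?thesis .
qed

lemma (in real_distribution) expectation_one_minus_cos:
  "(\<integral>\<^sup>+x. ennreal (1 - cos (u * x)) \<partial>M) = ennreal (1 - Re (char M u))"
proof -
  have int: "integrable M (\<lambda>x. iexp (u * x))"
    using integrable_iexp[of "\<lambda>x. complex_of_real (u * x)"] by simp
  have cos: "cos (u * x) = Re (iexp (u * x))" for x
    by (simp add: Re_exp)
  have cos_int: "integrable M (\<lambda>x. cos (u * x))"
    unfolding cos by (intro integrable_Re int)
  have "(\<integral>x. 1 - cos (u * x) \<partial>M) = 1 - Re (char M u)"
    using cos_int prob_space unfolding char_def
    by (subst Bochner_Integration.integral_diff)
       (simp_all only: cos integral_Re[OF int], simp_all del: space_eq_univ)
  then show ?thesis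
    using cos_int by (subst nn_integral_eq_integral) auto
qed

text \<open>The scaling identity writes \<open>\<bar>x\<bar> powr \<beta>\<close> as an integral
  over u; Tonelli then lets the expectation act on \<open>1 - cos (u * x)\<close> alone. The result
  is used once to calibrate the constant and once to compute the stable moment.\<close>

lemma (in real_distribution) nn_integral_abs_powr_eq_char:
  assumes "\<beta> > 0"
  shows "(\<integral>\<^sup>+u\<in>{0<..}. ennreal ((1 - cos u) * u powr (- 1 - \<beta>)) \<partial>lborel)
           * (\<integral>\<^sup>+x. ennreal (\<bar>x\<bar> powr \<beta>) \<partial>M)
         = (\<integral>\<^sup>+u\<in>{0<..}. ennreal ((1 - Re (char M u)) * u powr (- 1 - \<beta>)) \<partial>lborel)"
    (is "?C * _ = _")
proof -
  interpret pair_sigma_finite lborel M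
    by (intro pair_sigma_finite.intro sigma_finite_measure_axioms sigma_finite_lborel)
  let ?k = "\<lambda>u x. ennreal ((1 - cos (u * x)) * u powr (- 1 - \<beta>)) * indicator {0<..} u"
  have "?C * (\<integral>\<^sup>+x. ennreal (\<bar>x\<bar> powr \<beta>) \<partial>M) = (\<integral>\<^sup>+x. ?C * ennreal (\<bar>x\<bar> powr \<beta>) \<partial>M)"
    by (rule nn_integral_cmult[symmetric]) measurable
  also have "\<dots> = (\<integral>\<^sup>+x. \<integral>\<^sup>+u. ?k u x \<partial>lborel \<partial>M)"
    by (simp add: nn_integral_one_minus_cos_scale[OF assms])
  also have "\<dots> = (\<integral>\<^sup>+u. \<integral>\<^sup>+x. ?k u x \<partial>M \<partial>lborel)"
    by (rule Fubini') measurable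
  also have "\<dots> = (\<integral>\<^sup>+u\<in>{0<..}. ennreal ((1 - Re (char M u)) * u powr (- 1 - \<beta>)) \<partial>lborel)"
  proof (intro nn_integral_cong)
    fix u :: real
    have "Re (char M u) \<le> 1"
      using complex_Re_le_cmod[of "char M u"] cmod_char_le_1[of u] by linarith
    have "(\<integral>\<^sup>+x. ?k u x \<partial>M)
        = (\<integral>\<^sup>+x. ennreal (1 - cos (u * x)) * (ennreal (u powr (- 1 - \<beta>)) * indicator {0<..} u) \<partial>M)"
      by (intro nn_integral_cong) (simp add: ennreal_mult mult.assoc)
    also have "\<dots> = ennreal (1 - Re (char M u)) * (ennreal (u powr (- 1 - \<beta>)) * indicator {0<..} u)"
      by (simp add: nn_integral_multc expectation_one_minus_cos)
    finally show "(\<integral>\<^sup>+x. ?k u x \<partial>M)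
        = ennreal ((1 - Re (char M u)) * u powr (- 1 - \<beta>)) * indicator {0<..} u"
      using \<open>Re (char M u) \<le> 1\<close> by (simp add: ennreal_mult mult.assoc)
  qed
  finally show ?thesis .
qed

section \<open>Calibration by the standard normal law\<close>

lemma nn_integral_std_normal_abs_powr:
  fixes \<beta> :: real
  assumes "\<beta> > 0"
  shows "(\<integral>\<^sup>+x. ennreal (\<bar>x\<bar> powr \<beta>) \<partial>std_normal_distribution)
         = ennreal (2 powr (\<beta> / 2) * Gamma ((\<beta> + 1) / 2) / sqrt pi)"
proof -
  let ?f = "\<lambda>x. ennreal (std_normal_density x * \<bar>x\<bar> powr \<beta>)"
  have "(\<integral>\<^sup>+x. ennreal (\<bar>x\<bar> powr \<beta>) \<partial>std_normal_distribution) = (\<integral>\<^sup>+x. ?f x \<partial>lborel)"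
    by (subst nn_integral_density) (auto simp: ennreal_mult normal_density_nonneg)
  \<comment> \<open>This split is a pointwise identity: the omitted point 0 contributes nothing,
    since \<open>0 powr \<beta>\<close> is 0.\<close>
  also have "\<dots> = (\<integral>\<^sup>+x. ?f x * indicator {0<..} x + ?f x * indicator {..<0} x \<partial>lborel)"
    using assms by (intro nn_integral_cong) (auto simp: indicator_def)
  also have "\<dots> = (\<integral>\<^sup>+x\<in>{0<..}. ?f x \<partial>lborel) + (\<integral>\<^sup>+x\<in>{..<0}. ?f x \<partial>lborel)"
    by (intro nn_integral_add) auto
  also have "(\<integral>\<^sup>+x\<in>{..<0}. ?f x \<partial>lborel) = (\<integral>\<^sup>+x\<in>{0<..}. ?f x \<partial>lborel)"
    by (subst nn_integral_real_affine[of _ "-1" 0])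
       (auto simp: indicator_def std_normal_density_def intro!: nn_integral_cong)
  also have "(\<integral>\<^sup>+x\<in>{0<..}. ?f x \<partial>lborel)
      = (\<integral>\<^sup>+x. ennreal (1 / sqrt (2 * pi)) *
          (ennreal (x powr ((\<beta> + 1) - 1) * exp (- (1 / 2 * x powr 2))) * indicator {0<..} x) \<partial>lborel)"
    by (intro nn_integral_cong)
       (auto simp: indicator_def std_normal_density_def mult_ac simp flip: ennreal_mult)
  also have "\<dots> = ennreal (1 / sqrt (2 * pi)) *
      ennreal ((1 / 2) powr (- (\<beta> + 1) / 2) * Gamma ((\<beta> + 1) / 2) / 2)"
    using assms nn_integral_powr_exp_powr[of "\<beta> + 1" "1 / 2" 2]
    by (subst nn_integral_cmult) simp_all
  also have "\<dots> = ennreal (1 / sqrt (2 * pi) *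
      ((1 / 2) powr (- (\<beta> + 1) / 2) * Gamma ((\<beta> + 1) / 2) / 2))" (is "_ = ennreal ?I")
    using assms by (intro ennreal_mult[symmetric]) auto
  also have "ennreal ?I + ennreal ?I = ennreal (?I + ?I)"
    using assms by (intro ennreal_plus[symmetric]) auto
  also have "?I + ?I = 2 powr (\<beta> / 2) * Gamma ((\<beta> + 1) / 2) / sqrt pi"
  proof -
    \<comment> \<open>The extra factor \<open>sqrt 2\<close> cancels against the one in
      \<open>sqrt (2 * pi)\<close>.\<close>
    have "(1 / 2 :: real) powr (- (\<beta> + 1) / 2) = 2 powr (\<beta> / 2 + 1 / 2)"
      by (simp add: powr_divide powr_minus_divide[symmetric] add_divide_distrib diff_divide_distrib add.commute)
    also have "\<dots> = 2 powr (\<beta> / 2) * sqrt 2"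
      by (simp add: powr_add powr_half_sqrt)
    finally show ?thesis
      by (simp add: real_sqrt_mult)
  qed
  finally show ?thesis .
qed

text \<open>No direct evaluation is made. For the standard normal law both the moment
  \<open>G\<close> and the transform integral \<open>K\<close> (\<alpha> = 2, c = 1/2) are known, so
  the constant is \<open>K / G\<close>; \<beta> < 2 is the condition \<beta> < \<alpha> for this
  law.\<close>

lemma nn_integral_one_minus_cos:
  fixes \<beta> :: real
  assumes "0 < \<beta>" "\<beta> < 2"
  shows "(\<integral>\<^sup>+u\<in>{0<..}. ennreal ((1 - cos u) * u powr (- 1 - \<beta>)) \<partial>lborel)
         = ennreal (sqrt pi * Gamma (1 - \<beta> / 2) / (2 powr \<beta> * \<beta> * Gamma ((\<beta> + 1) / 2)))"
    (is "?C = _")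
proof -
  interpret real_distribution std_normal_distribution by (rule real_dist_normal_dist)
  define G where "G = 2 powr (\<beta> / 2) * Gamma ((\<beta> + 1) / 2) / sqrt pi"
  define K where "K = (1 / 2) powr (\<beta> / 2) * Gamma (1 - \<beta> / 2) / \<beta>"
  have "G > 0" "K > 0"
    using assms by (auto simp: G_def K_def)
  have "?C * ennreal G = ?C * (\<integral>\<^sup>+x. ennreal (\<bar>x\<bar> powr \<beta>) \<partial>std_normal_distribution)"
    using assms by (simp add: G_def nn_integral_std_normal_abs_powr)
  also have "\<dots> = (\<integral>\<^sup>+u\<in>{0<..}. ennreal ((1 - Re (char std_normal_distribution u)) * u powr (- 1 - \<beta>)) \<partial>lborel)"
    using assms by (intro nn_integral_abs_powr_eq_char)
  also have "\<dots> = (\<integral>\<^sup>+u\<in>{0<..}. ennreal ((1 - exp (- (1 / 2 * u powr 2))) * u powr (- 1 - \<beta>)) \<partial>lborel)"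
    by (intro nn_integral_cong) (auto simp: char_std_normal_distribution indicator_def)
  also have "\<dots> = ennreal K"
    using assms by (subst nn_integral_one_minus_exp_powr) (auto simp: K_def)
  finally have CG: "?C * ennreal G = ennreal K" .
  have "?C = ennreal (K / G)"
    using \<open>G > 0\<close> \<open>K > 0\<close> CG by (intro ennreal_eq_divideI) (simp_all add: mult.commute)
  also have "K / G = sqrt pi * Gamma (1 - \<beta> / 2) / (2 powr \<beta> * \<beta> * Gamma ((\<beta> + 1) / 2))"
  proof -
    have "(1 / 2 :: real) powr (\<beta> / 2) = 1 / 2 powr (\<beta> / 2)"
      by (simp add: powr_divide)
    moreover have "(2::real) powr \<beta> = 2 powr (\<beta> / 2) * 2 powr (\<beta> / 2)"
      by (simp flip: powr_add)
    ultimately show ?thesis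
      by (simp add: K_def G_def mult_ac)
  qed
  finally show ?thesis .
qed

section \<open>Absolute moments of symmetric stable laws\<close>

text \<open>The integrals produce Gamma at positive arguments, whereas \<open>moment_const\<close>
  has negative ones. Since -x lies strictly between -1 and 0, it is no pole and the functional
  equation applies.\<close>

lemma Gamma_one_minus:
  fixes x :: real
  assumes "0 < x" "x < 1"
  shows "Gamma (1 - x) = - x * Gamma (- x)"
proof -
  have "- x \<notin> \<int>\<^sub>\<le>\<^sub>0"
  proof
    assume "- x \<in> \<int>\<^sub>\<le>\<^sub>0"
    then obtain n where "- x = real_of_int n"
      by (elim nonpos_Ints_cases)
    with assms have "- 1 < n" "n < 0" by linarith+
    then show False by simp
  qed
  then show ?thesis
    using Gamma_plus1[of "- x"] by simp
qed

lemma (in real_distribution) stable_abs_moment: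
  assumes char: "\<And>u. char M u = complex_of_real (exp (- (c * \<bar>u\<bar> powr \<alpha>)))"
    and "c > 0" "0 < \<beta>" "\<beta> < \<alpha>" "\<alpha> \<le> 2"
  shows "integrable M (\<lambda>x. \<bar>x\<bar> powr \<beta>)"
    and "(\<integral>x. \<bar>x\<bar> powr \<beta> \<partial>M) = moment_const \<beta> \<alpha> * c powr (\<beta> / \<alpha>)"
proof -
  define C where "C = sqrt pi * Gamma (1 - \<beta> / 2) / (2 powr \<beta> * \<beta> * Gamma ((\<beta> + 1) / 2))"
  define K where "K = c powr (\<beta> / \<alpha>) * Gamma (1 - \<beta> / \<alpha>) / \<beta>"
  have "C > 0" "K > 0"
    using assms by (auto simp: C_def K_def)
  have "ennreal C * (\<integral>\<^sup>+x. ennreal (\<bar>x\<bar> powr \<beta>) \<partial>M)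
      = (\<integral>\<^sup>+u\<in>{0<..}. ennreal ((1 - Re (char M u)) * u powr (- 1 - \<beta>)) \<partial>lborel)"
    using assms nn_integral_one_minus_cos[of \<beta>] nn_integral_abs_powr_eq_char[of \<beta>]
    by (simp add: C_def)
  also have "\<dots> = (\<integral>\<^sup>+u\<in>{0<..}. ennreal ((1 - exp (- (c * u powr \<alpha>))) * u powr (- 1 - \<beta>)) \<partial>lborel)"
    by (intro nn_integral_cong) (auto simp: char indicator_def)
  also have "\<dots> = ennreal K"
    using assms by (subst nn_integral_one_minus_exp_powr) (auto simp: K_def)
  finally have "(\<integral>\<^sup>+x. ennreal (\<bar>x\<bar> powr \<beta>) \<partial>M) = ennreal (K / C)"
    using \<open>C > 0\<close> \<open>K > 0\<close> by (intro ennreal_eq_divideI) simp_all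
  then have *: "integrable M (\<lambda>x. \<bar>x\<bar> powr \<beta>) \<and> (\<integral>x. \<bar>x\<bar> powr \<beta> \<partial>M) = K / C"
    using \<open>C > 0\<close> \<open>K > 0\<close> by (subst (asm) nn_integral_eq_integrable) auto
  then show "integrable M (\<lambda>x. \<bar>x\<bar> powr \<beta>)" ..
  \<comment> \<open>The quotient of the factors \<open>- (\<beta> / \<alpha>)\<close> and
    \<open>- (\<beta> / 2)\<close> is \<open>2 / \<alpha>\<close>: the signs cancel, and
    \<open>2 powr \<beta>\<close> becomes \<open>2 powr (\<beta> + 1)\<close>.\<close>
  have "Gamma (1 - \<beta> / 2) = - (\<beta> / 2) * Gamma (- \<beta> / 2)"
       "Gamma (1 - \<beta> / \<alpha>) = - (\<beta> / \<alpha>) * Gamma (- \<beta> / \<alpha>)"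
    using assms Gamma_one_minus[of "\<beta> / 2"] Gamma_one_minus[of "\<beta> / \<alpha>"] by simp_all
  then have "K / C = moment_const \<beta> \<alpha> * c powr (\<beta> / \<alpha>)"
    using assms by (simp add: K_def C_def moment_const_def powr_add mult_ac)
  with * show "(\<integral>x. \<bar>x\<bar> powr \<beta> \<partial>M) = moment_const \<beta> \<alpha> * c powr (\<beta> / \<alpha>)"
    by simp
qed

section \<open>Degeneracy for index above 2\<close>

text \<open>Take expectations in the pointwise cosine bound, whose two sides differ by twice a
  square. Consequently \<open>1 - Re (char M u)\<close> cannot vanish faster than quadratically at 0
  along halvings, unless it is 0.\<close>

lemma (in real_distribution) one_minus_Re_char_double_le:
  "1 - Re (char M (2 * u)) \<le> 4 * (1 - Re (char M u))"
proof -
  have le: "1 - cos (2 * u * x) \<le> 4 * (1 - cos (u * x))" for x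
  proof -
    have "4 * (1 - cos (u * x)) - (1 - cos (2 * u * x)) = 2 * (1 - cos (u * x))\<^sup>2"
      using cos_double_cos[of "u * x"] by (simp add: power2_eq_square algebra_simps)
    then show ?thesis
      using zero_le_power2[of "1 - cos (u * x)"] by linarith
  qed
  have Re_le: "Re (char M v) \<le> 1" for v
    using complex_Re_le_cmod[of "char M v"] cmod_char_le_1[of v] by linarith
  have "ennreal (1 - Re (char M (2 * u))) = (\<integral>\<^sup>+x. ennreal (1 - cos (2 * u * x)) \<partial>M)"
    by (rule expectation_one_minus_cos[symmetric])
  also have "\<dots> \<le> (\<integral>\<^sup>+x. ennreal 4 * ennreal (1 - cos (u * x)) \<partial>M)"
    using le by (intro nn_integral_mono) (simp flip: ennreal_mult del: ennreal_numeral)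
  also have "\<dots> = ennreal 4 * ennreal (1 - Re (char M u))"
    by (simp add: nn_integral_cmult expectation_one_minus_cos del: ennreal_numeral)
  also have "\<dots> = ennreal (4 * (1 - Re (char M u)))"
    using Re_le[of u] by (intro ennreal_mult[symmetric]) auto
  finally show ?thesis
    using Re_le[of u] by (simp add: ennreal_le_iff)
qed

text \<open>Doubling n times gives \<open>f 1 \<le> 4 ^ n * f ((1 / 2) ^ n)\<close>, while
  \<open>1 - exp (- y) \<le> y\<close> bounds \<open>f ((1 / 2) ^ n)\<close> by
  \<open>c * ((1 / 2) powr \<alpha>) ^ n\<close>. For \<alpha> > 2 the product tends to 0, so
  \<open>f 1\<close>, which is \<open>1 - exp (- c)\<close>, vanishes.\<close>

lemma (in real_distribution) stable_index_gt_2_imp_scale_0: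
  assumes char: "\<And>u. char M u = complex_of_real (exp (- (c * \<bar>u\<bar> powr \<alpha>)))"
    and "c \<ge> 0" "\<alpha> > 2"
  shows "c = 0"
proof -
  define f where "f = (\<lambda>u. 1 - Re (char M u))"
  have f_pow: "f 1 \<le> 4 ^ n * f ((1 / 2) ^ n)" for n
  proof (induction n)
    case (Suc n)
    have "f ((1 / 2) ^ n) \<le> 4 * f ((1 / 2) ^ Suc n)"
      using one_minus_Re_char_double_le[of "(1 / 2) ^ Suc n"] by (simp add: f_def)
    then have "4 ^ n * f ((1 / 2) ^ n) \<le> 4 ^ n * (4 * f ((1 / 2) ^ Suc n))"
      by (intro mult_left_mono) auto
    also have "\<dots> = 4 ^ Suc n * f ((1 / 2) ^ Suc n)" by simp
    finally show ?case using Suc.IH by (rule order_trans[rotated])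
  qed simp
  have "f 1 \<le> c * (4 * (1 / 2) powr \<alpha>) ^ n" for n
  proof -
    have "f ((1 / 2) ^ n) \<le> c * ((1 / 2) ^ n) powr \<alpha>"
      using exp_ge_add_one_self[of "- (c * ((1 / 2) ^ n) powr \<alpha>)"] by (simp add: f_def char)
    also have "((1 / 2 :: real) ^ n) powr \<alpha> = ((1 / 2) powr \<alpha>) ^ n"
      by (simp add: powr_powr mult.commute flip: powr_realpow)
    finally have "4 ^ n * f ((1 / 2) ^ n) \<le> 4 ^ n * (c * ((1 / 2) powr \<alpha>) ^ n)"
      by (intro mult_left_mono) auto
    also have "\<dots> = c * (4 * (1 / 2) powr \<alpha>) ^ n"
      by (simp add: power_mult_distrib)
    finally show ?thesis
      using f_pow[of n] by (rule order_trans[rotated])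
  qed
  moreover have "(\<lambda>n. c * (4 * (1 / 2) powr \<alpha>) ^ n) \<longlonglongrightarrow> 0"
  proof -
    have "(1 / 2 :: real) powr \<alpha> < (1 / 2) powr 2"
      using assms by (intro powr_less_mono') auto
    then have "\<bar>4 * (1 / 2 :: real) powr \<alpha>\<bar> < 1"
      by (simp add: abs_mult power2_eq_square)
    then show ?thesis
      by (intro tendsto_mult_right_zero LIMSEQ_power_zero) simp
  qed
  ultimately have "f 1 \<le> 0"
    by (intro LIMSEQ_le_const) auto
  then show ?thesis
    using assms by (simp add: f_def char)
qed

lemma (in real_distribution) char_eq_1_imp_return_0:
  assumes "\<And>u. char M u = 1"
  shows "M = return borel 0"
proof (rule Levy_uniqueness)
  show "real_distribution (return borel (0::real))"
    by (simp add: real_distribution_def real_distribution_axioms_def prob_space_return)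
  show "char M = char (return borel 0)"
    using assms by (simp add: fun_eq_iff char_def integral_return)
qed (rule real_distribution_axioms)

text \<open>Reflection replaces u by -u in the characteristic function, so by Levy uniqueness an
  even one belongs to a symmetric law.\<close>

lemma (in real_distribution) distr_uminus_eq_self:
  assumes "\<And>u. char M (- u) = char M u"
  shows "distr M borel uminus = M"
proof (rule Levy_uniqueness)
  show "char (distr M borel uminus) = char M"
  proof
    fix u
    have "char (distr M borel uminus) u = char M (- u)"
      unfolding char_def by (subst integral_distr) auto
    then show "char (distr M borel uminus) u = char M u" using assms by simp
  qed
qed (auto intro: real_distribution_axioms)

section \<open>From absolute moments to branch moments\<close>

lemma branch_power_measurable [measurable]: "(\<lambda>x. branch_power x \<beta>) \<in> borel_measurable borel"
  unfolding branch_power_def by measurable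

text \<open>With \<open>x = pi * \<beta> / 2\<close> this is the source of the cosine and phase
  factors in the theorem.\<close>

lemma one_plus_exp_i:
  "1 + exp (\<i> * complex_of_real (2 * x)) = 2 * (complex_of_real (cos x) * exp (\<i> * complex_of_real x))"
proof -
  have "cos (2 * x) + 1 = 2 * (cos x * cos x)"
    using cos_double_cos[of x] by (simp add: power2_eq_square)
  then show ?thesis
    by (simp add: complex_eq_iff Re_exp Im_exp sin_double)
qed

text \<open>By symmetry the integrand may be averaged over x and -x. For x \<noteq> 0 exactly one of
  the two is negative, so their branch powers add up to \<open>\<bar>x\<bar> powr \<beta>\<close>
  times \<open>1 + exp (\<i> * complex_of_real (pi * \<beta>))\<close>; at 0 everything
  vanishes.\<close>

lemma (in real_distribution) integral_branch_power_symmetric: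
  assumes sym: "distr M borel uminus = M"
    and int: "integrable M (\<lambda>x. \<bar>x\<bar> powr \<beta>)" and "\<beta> > 0"
  shows "(\<integral>x. branch_power x \<beta> \<partial>M) =
    complex_of_real (\<integral>x. \<bar>x\<bar> powr \<beta> \<partial>M) *
      (complex_of_real (cos (pi * \<beta> / 2)) * exp (\<i> * complex_of_real (\<beta> * pi / 2)))"
proof -
  have norm_exp: "norm (exp (\<i> * (complex_of_real pi * complex_of_real \<beta>))) = 1"
    using norm_exp_i_times[of "pi * \<beta>"] by simp
  \<comment> \<open>The phase has modulus 1, so the absolute power dominates.\<close>
  have int_b: "integrable M (\<lambda>x. branch_power x \<beta>)"
    by (rule Bochner_Integration.integrable_bound[OF int])
       (auto simp: branch_power_def norm_mult norm_exp)
  have b_neg: "(\<integral>x. branch_power (- x) \<beta> \<partial>M) = (\<integral>x. branch_power x \<beta> \<partial>M)"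
    using integral_distr[of uminus M borel "\<lambda>x. branch_power x \<beta>"] by (simp add: sym)
  have int_neg: "integrable M (\<lambda>x. branch_power (- x) \<beta>)"
    using integrable_distr_eq[of uminus M borel "\<lambda>x. branch_power x \<beta>"] int_b by (simp add: sym)
  have "2 * (\<integral>x. branch_power x \<beta> \<partial>M) = (\<integral>x. branch_power x \<beta> + branch_power (- x) \<beta> \<partial>M)"
    using int_b int_neg by (simp add: b_neg)
  also have "\<dots> = (\<integral>x. complex_of_real (\<bar>x\<bar> powr \<beta>) * (1 + exp (\<i> * complex_of_real (pi * \<beta>))) \<partial>M)"
    using assms by (intro Bochner_Integration.integral_cong) (auto simp: branch_power_def algebra_simps)
  also have "\<dots> = complex_of_real (\<integral>x. \<bar>x\<bar> powr \<beta> \<partial>M) * (1 + exp (\<i> * complex_of_real (pi * \<beta>)))"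
    by simp
  also have "1 + exp (\<i> * complex_of_real (pi * \<beta>))
      = 2 * (complex_of_real (cos (pi * \<beta> / 2)) * exp (\<i> * complex_of_real (\<beta> * pi / 2)))"
    using one_plus_exp_i[of "pi * \<beta> / 2"] by (simp add: mult.commute)
  finally show ?thesis by simp
qed

lemma (in real_distribution) stable_moment:
  assumes char: "\<And>u. char M u = complex_of_real (exp (- (c * \<bar>u\<bar> powr \<alpha>)))"
    and "c \<ge> 0" "0 < \<beta>" "\<beta> < \<alpha>"
  shows "integrable M (\<lambda>x. \<bar>x\<bar> powr \<beta>)"
    and "(\<integral>x. branch_power x \<beta> \<partial>M) =
      complex_of_real (moment_const \<beta> \<alpha> * c powr (\<beta> / \<alpha>)) *
      (complex_of_real (cos (pi * \<beta> / 2)) * exp (\<i> * complex_of_real (\<beta> * pi / 2)))"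
proof -
  have *: "integrable M (\<lambda>x. \<bar>x\<bar> powr \<beta>) \<and>
    (\<integral>x. \<bar>x\<bar> powr \<beta> \<partial>M) = moment_const \<beta> \<alpha> * c powr (\<beta> / \<alpha>)"
  proof (cases "c = 0")
    case True
    \<comment> \<open>For c = 0 the law is the point mass at 0: the moment is 0, and so is the right
      side because \<open>0 powr (\<beta> / \<alpha>)\<close> is 0.\<close>
    then have M: "M = return borel 0"
      using char by (intro char_eq_1_imp_return_0) simp
    have "AE x in M. \<bar>x\<bar> powr \<beta> = 0"
      unfolding M by (subst AE_return) auto
    then show ?thesis
      using True by (simp add: integrable_cong_AE[where g = "\<lambda>_. 0"] integral_cong_AE[where g = "\<lambda>_. 0"])
  next
    case False
    then have "c > 0" "\<alpha> \<le> 2"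
      using assms stable_index_gt_2_imp_scale_0[of c \<alpha>] by force+
    then show ?thesis
      using assms stable_abs_moment[of c \<alpha> \<beta>] by blast
  qed
  then show "integrable M (\<lambda>x. \<bar>x\<bar> powr \<beta>)" ..
  have "distr M borel uminus = M"
    by (rule distr_uminus_eq_self) (simp add: char)
  with * show "(\<integral>x. branch_power x \<beta> \<partial>M) =
      complex_of_real (moment_const \<beta> \<alpha> * c powr (\<beta> / \<alpha>)) *
      (complex_of_real (cos (pi * \<beta> / 2)) * exp (\<i> * complex_of_real (\<beta> * pi / 2)))"
    using assms by (subst integral_branch_power_symmetric) auto
qed

section \<open>Reality of the exponent and the projected law\<close>

text \<open>A single value of s would determine z only modulo a period of the exponential. Realness
  for every s > 0 gives \<open>sin (s * Im z) = 0\<close> throughout, which forces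
  \<open>Im z = 0\<close>; the norm bound at s = 1 gives the sign of \<open>Re z\<close>.\<close>

lemma exponent_real_nonneg:
  fixes z :: complex
  assumes norm: "\<And>s. s > 0 \<Longrightarrow> norm (exp (- complex_of_real s * z)) \<le> 1"
    and real: "\<And>s. s > 0 \<Longrightarrow> cnj (exp (- complex_of_real s * z)) = exp (- complex_of_real s * z)"
  obtains p where "p \<ge> 0" "z = complex_of_real p"
proof
  show "Re z \<ge> 0"
    using norm[of 1] by simp
  have sin: "sin (s * Im z) = 0" if "s > 0" for s
  proof -
    have "Im (exp (- complex_of_real s * z)) = 0"
      using real[OF that] by (metis Reals_cnj_iff complex_is_Real_iff)
    then show ?thesis by (simp add: Im_exp)
  qed
  have "Im z = 0"
  proof (rule ccontr)
    assume "Im z \<noteq> 0"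
    \<comment> \<open>This s makes \<open>s * Im z\<close> equal to plus or minus
      \<open>pi / 2\<close>, where the sine is not 0.\<close>
    then have "sin (pi / (2 * \<bar>Im z\<bar>) * Im z) = 0"
      by (intro sin) simp
    moreover have "pi / (2 * \<bar>Im z\<bar>) * Im z = pi / 2 \<or> pi / (2 * \<bar>Im z\<bar>) * Im z = - (pi / 2)"
      using \<open>Im z \<noteq> 0\<close> by (cases "Im z > 0") (auto simp: field_simps)
    ultimately show False
      by (metis sin_minus sin_pi_half neg_equal_0_iff_equal zero_neq_one)
  qed
  then show "z = complex_of_real (Re z)"
    by (simp add: complex_eq_iff)
qed

theorem mainTheorem1:
  fixes M :: "'a measure"
    and L :: "real \<Rightarrow> 'a \<Rightarrow> real ^ 'n"
    and \<phi> :: "real ^ 'n \<Rightarrow> complex"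
    and \<mu> \<beta> t :: real
    and \<sigma> :: "real ^ 'n"
  assumes "prob_space M"
    and "\<mu> > 0"
    and "\<And>s. s > 0 \<Longrightarrow> L s \<in> borel_measurable M"
    and "\<And>k s. s > 0 \<Longrightarrow>
           (\<integral>\<omega>. exp (\<i> * complex_of_real (k \<bullet> L s \<omega>)) \<partial>M) = exp (- complex_of_real s * \<phi> k)"
    and "\<And>k. \<phi> (- k) = \<phi> k"
    and "\<And>k. k \<noteq> 0 \<Longrightarrow>
           \<phi> k = complex_of_real (norm k powr (real CARD('n) * \<mu>)) * \<phi> (k /\<^sub>R norm k)"
    and "\<sigma> \<noteq> 0"
    and "0 < \<beta>" and "\<beta> < real CARD('n) * \<mu>"
    and "t > 0"
  shows "integrable M (\<lambda>\<omega>. \<bar>\<sigma> \<bullet> L t \<omega>\<bar> powr \<beta>) \<and>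
    (\<integral>\<omega>. branch_power (\<sigma> \<bullet> L t \<omega>) \<beta> \<partial>M) =
      complex_of_real (moment_const \<beta> (real CARD('n) * \<mu>))
      * complex_of_real ((norm \<sigma> * t powr (1 / (real CARD('n) * \<mu>))) powr \<beta>)
      * (complex_of_real (cos (pi * \<beta> / 2)) * exp (\<i> * complex_of_real (\<beta> * pi / 2)))
      * \<phi> (\<sigma> /\<^sub>R norm \<sigma>) powr complex_of_real (\<beta> / (real CARD('n) * \<mu>))"
proof -
  interpret prob_space M by fact
  note L_meas [measurable] = assms(3)
  note char_L = assms(4) and even = assms(5) and homog = assms(6)
  define \<alpha> where "\<alpha> = real CARD('n) * \<mu>"
  define e where "e = \<sigma> /\<^sub>R norm \<sigma>"
  have \<alpha>: "\<alpha> > 0" "\<beta> < \<alpha>"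
    using assms by (simp_all add: \<alpha>_def)
  have char_le: "norm (exp (- complex_of_real s * \<phi> e)) \<le> 1" if "s > 0" for s
  proof -
    have "norm (\<integral>\<omega>. exp (\<i> * complex_of_real (e \<bullet> L s \<omega>)) \<partial>M) \<le> (\<integral>\<omega>. 1 \<partial>M)"
      by (rule order_trans[OF integral_norm_bound]) (simp add: prob_space)
    then show ?thesis
      by (simp only: char_L[OF that] lebesgue_integral_const) (simp add: prob_space)
  qed
  \<comment> \<open>Conjugation replaces e by -e, and evenness of \<phi> undoes it.\<close>
  have char_cnj: "cnj (exp (- complex_of_real s * \<phi> e)) = exp (- complex_of_real s * \<phi> e)"
    if "s > 0" for s
  proof -
    have "cnj (exp (- complex_of_real s * \<phi> e)) = cnj (\<integral>\<omega>. exp (\<i> * complex_of_real (e \<bullet> L s \<omega>)) \<partial>M)"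
      by (simp only: char_L[OF that])
    also have "\<dots> = (\<integral>\<omega>. exp (\<i> * complex_of_real (- e \<bullet> L s \<omega>)) \<partial>M)"
      by (subst Bochner_Integration.integral_cnj[symmetric])
        (simp add: exp_cnj del: Bochner_Integration.integral_cnj)
    also have "\<dots> = exp (- complex_of_real s * \<phi> e)"
      by (simp only: char_L[OF that] even)
    finally show ?thesis .
  qed
  from exponent_real_nonneg[OF char_le char_cnj]
  obtain p where p: "p \<ge> 0" "\<phi> e = complex_of_real p" by blast
  \<comment> \<open>By homogeneity, t times \<phi> at \<open>u *\<^sub>R \<sigma>\<close> is
    \<open>c * \<bar>u\<bar> powr \<alpha>\<close>, so \<open>c\<close> is the scale of the
    projection \<open>X\<close>.\<close>
  define c where "c = t * norm \<sigma> powr \<alpha> * p"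
  define X where "X = (\<lambda>\<omega>. \<sigma> \<bullet> L t \<omega>)"
  have [measurable]: "X \<in> borel_measurable M"
    using L_meas[OF \<open>t > 0\<close>] unfolding X_def by measurable
  interpret N: real_distribution "distr M borel X"
    by (rule real_distribution_distr) measurable
  have phi_ray: "\<phi> (u *\<^sub>R \<sigma>) = complex_of_real ((\<bar>u\<bar> * norm \<sigma>) powr \<alpha> * p)" if "u \<noteq> 0" for u
  proof -
    \<comment> \<open>The unit direction is e or -e according to the sign of u; evenness identifies
      the two values of \<phi>.\<close>
    have "(u *\<^sub>R \<sigma>) /\<^sub>R norm (u *\<^sub>R \<sigma>) = sgn u *\<^sub>R e"
      using that by (simp add: e_def sgn_real_def)
    then have "\<phi> ((u *\<^sub>R \<sigma>) /\<^sub>R norm (u *\<^sub>R \<sigma>)) = \<phi> e"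
      using that even[of e] by (simp add: sgn_real_def)
    then show ?thesis
      using homog[of "u *\<^sub>R \<sigma>"] that \<open>\<sigma> \<noteq> 0\<close> p by (simp add: \<alpha>_def)
  qed
  have char_N: "char (distr M borel X) u = complex_of_real (exp (- (c * \<bar>u\<bar> powr \<alpha>)))" for u
  \<comment> \<open>Homogeneity says nothing at the origin. There the characteristic function is 1,
    matching \<open>0 powr \<alpha>\<close> = 0 in the exponent.\<close>
  proof (cases "u = 0")
    case True
    then show ?thesis by (simp add: N.char_zero)
  next
    case False
    have "char (distr M borel X) u = (\<integral>\<omega>. exp (\<i> * complex_of_real ((u *\<^sub>R \<sigma>) \<bullet> L t \<omega>)) \<partial>M)"
      unfolding char_def by (subst integral_distr) (measurable, simp add: X_def)
    also have "\<dots> = exp (- complex_of_real t * complex_of_real ((\<bar>u\<bar> * norm \<sigma>) powr \<alpha> * p))"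
      using \<open>t > 0\<close> by (simp only: char_L phi_ray[OF False])
    also have "\<dots> = exp (complex_of_real (- (c * \<bar>u\<bar> powr \<alpha>)))"
      by (simp add: c_def powr_mult mult_ac)
    finally show ?thesis by (simp only: exp_of_real)
  qed
  have "c \<ge> 0"
    using p \<open>t > 0\<close> by (simp add: c_def)
  note moment = N.stable_moment[OF char_N \<open>c \<ge> 0\<close> \<open>0 < \<beta>\<close> \<open>\<beta> < \<alpha>\<close>]
  have "c powr (\<beta> / \<alpha>) = (norm \<sigma> * t powr (1 / \<alpha>)) powr \<beta> * p powr (\<beta> / \<alpha>)"
    using p \<open>t > 0\<close> \<alpha> by (simp add: c_def powr_mult powr_powr mult_ac)
  \<comment> \<open>Since \<open>p\<close> is a nonnegative real, the complex power is the real one,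
    also when \<open>p\<close> is 0.\<close>
  moreover have "\<phi> e powr complex_of_real (\<beta> / \<alpha>) = complex_of_real (p powr (\<beta> / \<alpha>))"
    by (simp only: p powr_of_real)
  moreover have "integrable M (\<lambda>\<omega>. \<bar>X \<omega>\<bar> powr \<beta>)"
    using moment(1) by (subst (asm) integrable_distr_eq) auto
  moreover have "(\<integral>\<omega>. branch_power (X \<omega>) \<beta> \<partial>M) = (\<integral>x. branch_power x \<beta> \<partial>distr M borel X)"
    by (rule integral_distr[symmetric]) measurable
  moreover have X: "\<sigma> \<bullet> L t \<omega> = X \<omega>" for \<omega>
    by (simp add: X_def)
  ultimately show ?thesis
    unfolding X e_def[symmetric] \<alpha>_def[symmetric] using moment(2) by (simp add: mult_ac)
qed

end
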